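(* Let $R$ be an associative ring with a nonzero ideal $I$ and a semiprime ideal $T$ such that $T\subsetneq I$. If $\mathrm{char}(R/T)\neq 2$ and $d:R\to R$ is a derivation such that $[d(x),x]d(x)\in T$ for all $x\in I$, then $d$ is $T$-commuting on $I$, i.e. $[d(x),x]\in T$ for all $x\in I$.
   Context: $[x,y]=xy-yx$ for $x,y\in R$. An ideal $T$ of $R$ is semiprime if, for $a\in R$, $aRa\subseteq T$ implies $a\in T$. A derivation of $R$ is an additive map $d:R\to R$ with $d(xy)=d(x)y+xd(y)$ for all $x,y\in R$. For a nonempty subset $K\subseteq R$, a derivation $d$ is called $T$-commuting on $K$ if $[d(x),x]\in T$ for all $x\in K$. $\mathrm{char}(R/T)$ denotes the characteristic of the quotient ring $R/T$. *)

theory Defs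
  imports Complex_Main
begin

text \<open>Associative rings, not assumed to be commutative or to have an identity, are the types of
  class \<^class>\<open>ring\<close>.\<close>

definition commutator :: "'a::ring \<Rightarrow> 'a \<Rightarrow> 'a"
  where "commutator x y = x * y - y * x"

definition two_sided_ideal :: "'a::ring set \<Rightarrow> bool"
  where "two_sided_ideal I \<longleftrightarrow>
    0 \<in> I \<and> (\<forall>x\<in>I. \<forall>y\<in>I. x - y \<in> I) \<and> (\<forall>x\<in>I. \<forall>r. r * x \<in> I \<and> x * r \<in> I)"

definition semiprime_ideal :: "'a::ring set \<Rightarrow> bool"
  where "semiprime_ideal T \<longleftrightarrow>
    two_sided_ideal T \<and> (\<forall>a. (\<forall>r. a * r * a \<in> T) \<longrightarrow> a \<in> T)"

definition derivation :: "('a::ring \<Rightarrow> 'a) \<Rightarrow> bool"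
  where "derivation d \<longleftrightarrow> additive d \<and> (\<forall>x y. d (x * y) = d x * y + x * d y)"

definition commuting_mod :: "'a::ring set \<Rightarrow> ('a \<Rightarrow> 'a) \<Rightarrow> 'a set \<Rightarrow> bool"
  where "commuting_mod T d K \<longleftrightarrow> (\<forall>x\<in>K. commutator (d x) x \<in> T)"

text \<open>The \<open>n\<close>-fold multiple of \<open>x\<close>, written as a sum because there is no identity to embed \<open>n\<close>.\<close>

definition nat_multiple :: "nat \<Rightarrow> 'a::ring \<Rightarrow> 'a"
  where "nat_multiple n x = (\<Sum>i<n. x)"

text \<open>The characteristic of the quotient ring \<open>R/T\<close>: the least \<open>n > 0\<close> that annihilates every
  coset \<open>x + T\<close>, that is, with \<open>n x \<in> T\<close> for all \<open>x\<close>, and \<open>0\<close> if there is no such \<open>n\<close>.\<close>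

definition quotient_char :: "'a::ring set \<Rightarrow> nat"
  where "quotient_char T =
    (if \<exists>n>0. \<forall>x. nat_multiple n x \<in> T
     then LEAST n. n > 0 \<and> (\<forall>x. nat_multiple n x \<in> T)
     else 0)"

end

theory Submission
  imports Defs
begin

text \<open>Since \<open>T\<close> is an intersection of prime ideals, one may work modulo a single prime \<open>P \<supseteq> T\<close>. The
  polarization of \<open>[D x, x] D x = 0\<close> shows that \<open>D\<close> maps \<open>P \<inter> I\<close> into \<open>P\<close>, unless \<open>I\<close> is
  central modulo \<open>P\<close>.

  If some \<open>w \<in> I - P\<close> satisfies \<open>w\<^sup>2 \<in> P\<close>, then modulo \<open>P\<close> one obtains successively \<open>w D w = 0\<close>,
  \<open>D w = 0\<close> and \<open>D = 0\<close> on \<open>I\<close>. If there is no such \<open>w\<close>, consider the elements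
  \<open>w = (D x) s [D x, x]\<close>, whose square vanishes by hypothesis: they all lie in \<open>P\<close>, hence
  \<open>D x \<in> P\<close> or \<open>[D x, x] \<in> P\<close>.

  The prime quotients may have characteristic \<open>2\<close>, whatever the characteristic of \<open>R/T\<close> is. There
  the components of the polarized identity of degree \<open>(2, 1)\<close> and \<open>(1, 2)\<close> are only known to have
  sum zero, and the step \<open>w D w = 0\<close> needs a separate argument.\<close>

section \<open>Prime ideals and quotient rings\<close>

lemma ideal_0: "two_sided_ideal Q \<Longrightarrow> 0 \<in> Q"
  and ideal_diff: "two_sided_ideal Q \<Longrightarrow> x \<in> Q \<Longrightarrow> y \<in> Q \<Longrightarrow> x - y \<in> Q"
  and ideal_mult_left: "two_sided_ideal Q \<Longrightarrow> x \<in> Q \<Longrightarrow> r * x \<in> Q"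
  and ideal_mult_right: "two_sided_ideal Q \<Longrightarrow> x \<in> Q \<Longrightarrow> x * r \<in> Q"
  by (simp_all add: two_sided_ideal_def)

lemma ideal_minus: "two_sided_ideal Q \<Longrightarrow> x \<in> Q \<Longrightarrow> - x \<in> Q"
  using ideal_diff[of Q 0 x] ideal_0[of Q] by simp

lemma ideal_add: "two_sided_ideal Q \<Longrightarrow> x \<in> Q \<Longrightarrow> y \<in> Q \<Longrightarrow> x + y \<in> Q"
  using ideal_diff[of Q x "- y"] ideal_minus[of Q y] by simp

lemma ideal_add_cong:
  "two_sided_ideal Q \<Longrightarrow> a - a' \<in> Q \<Longrightarrow> b - b' \<in> Q \<Longrightarrow> (a + b) - (a' + b') \<in> Q"
  by (simp only: add_diff_add ideal_add)

lemma ideal_diff_cong: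
  assumes "two_sided_ideal Q" "a - a' \<in> Q" "b - b' \<in> Q"
  shows "(a - b) - (a' - b') \<in> Q"
proof -
  have "(a - b) - (a' - b') = (a - a') - (b - b')" by simp
  then show ?thesis using assms by (simp only: ideal_diff)
qed

lemma ideal_minus_cong:
  "two_sided_ideal Q \<Longrightarrow> a - a' \<in> Q \<Longrightarrow> - a - - a' \<in> Q"
  by (simp only: minus_diff_minus ideal_minus)

lemma ideal_mult_cong:
  assumes "two_sided_ideal Q" "a - a' \<in> Q" "b - b' \<in> Q"
  shows "a * b - a' * b' \<in> Q"
proof -
  have "a * b - a' * b' = (a - a') * b + a' * (b - b')" by (simp add: algebra_simps)
  then show ?thesis using assms by (simp add: ideal_add ideal_mult_left ideal_mult_right)
qed

text \<open>No type of the logic can be the quotient by an ideal that is fixed inside a proof, but one type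
  can contain the quotients by all ideals: the product of the rings \<open>R/Q\<close>.\<close>

quotient_type (overloaded) 'a ideal_quotients = "'a::ring set \<Rightarrow> 'a" /
  "\<lambda>F G. \<forall>Q. two_sided_ideal Q \<longrightarrow> F Q - G Q \<in> Q"
proof (rule equivpI)
  show "reflp (\<lambda>F G :: 'a set \<Rightarrow> 'a. \<forall>Q. two_sided_ideal Q \<longrightarrow> F Q - G Q \<in> Q)"
    by (auto simp: reflp_def two_sided_ideal_def)
  show "symp (\<lambda>F G :: 'a set \<Rightarrow> 'a. \<forall>Q. two_sided_ideal Q \<longrightarrow> F Q - G Q \<in> Q)"
    unfolding symp_def by (metis minus_diff_eq ideal_minus)
  have "x - z \<in> Q" if "two_sided_ideal Q" "x - y \<in> Q" "y - z \<in> Q" for Q and x y z :: 'a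
  proof -
    have "(x - y) + (y - z) \<in> Q" using that by (rule ideal_add)
    then show ?thesis by simp
  qed
  then show "transp (\<lambda>F G :: 'a set \<Rightarrow> 'a. \<forall>Q. two_sided_ideal Q \<longrightarrow> F Q - G Q \<in> Q)"
    unfolding transp_def by blast
qed

instantiation ideal_quotients :: (ring) ring
begin

lift_definition zero_ideal_quotients :: "'a ideal_quotients" is "\<lambda>_. 0" .

lift_definition plus_ideal_quotients :: "'a ideal_quotients \<Rightarrow> 'a ideal_quotients \<Rightarrow> 'a ideal_quotients"
  is "\<lambda>F G Q. F Q + G Q"
  by (simp only: ideal_add_cong)

lift_definition uminus_ideal_quotients :: "'a ideal_quotients \<Rightarrow> 'a ideal_quotients"
  is "\<lambda>F Q. - F Q"
  by (simp only: ideal_minus_cong)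

lift_definition minus_ideal_quotients :: "'a ideal_quotients \<Rightarrow> 'a ideal_quotients \<Rightarrow> 'a ideal_quotients"
  is "\<lambda>F G Q. F Q - G Q"
  by (simp only: ideal_diff_cong)

lift_definition times_ideal_quotients :: "'a ideal_quotients \<Rightarrow> 'a ideal_quotients \<Rightarrow> 'a ideal_quotients"
  is "\<lambda>F G Q. F Q * G Q"
  by (simp only: ideal_mult_cong)

instance
proof
  fix a b c :: "'a ideal_quotients"
  show "a + b + c = a + (b + c)" by transfer (simp add: add.assoc ideal_0)
  show "a + b = b + a" by transfer (simp add: add.commute ideal_0)
  show "0 + a = a" by transfer (simp add: ideal_0)
  show "- a + a = 0" by transfer (simp add: ideal_0)
  show "a - b = a + - b" by transfer (simp add: ideal_0)
  show "a * b * c = a * (b * c)" by transfer (simp add: mult.assoc ideal_0)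
  show "(a + b) * c = a * c + b * c" by transfer (simp add: distrib_right ideal_0)
  show "a * (b + c) = a * b + a * c" by transfer (simp add: distrib_left ideal_0)
qed

end

text \<open>\<open>coset P\<close> is reduction modulo \<open>P\<close>, placed in a single factor
  of the product; for an ideal \<open>P\<close> its kernel is \<open>P\<close>.\<close>

lift_definition coset :: "'a::ring set \<Rightarrow> 'a \<Rightarrow> 'a ideal_quotients" is "\<lambda>P x Q. if Q = P then x else 0" .

lemma coset_add: "coset P (x + y) = coset P x + coset P y"
  and coset_mult: "coset P (x * y) = coset P x * coset P y"
  by (transfer, simp add: ideal_0)+

lemma coset_eq_0_iff: "two_sided_ideal P \<Longrightarrow> coset P x = 0 \<longleftrightarrow> x \<in> P"
  by transfer (simp add: ideal_0)

section \<open>Prime ideals over a semiprime ideal\<close>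

definition prime_ideal :: "'a::ring set \<Rightarrow> bool"
  where "prime_ideal P \<longleftrightarrow> two_sided_ideal P \<and> (\<forall>a b. (\<forall>r. a * r * b \<in> P) \<longrightarrow> a \<in> P \<or> b \<in> P)"

text \<open>The prime is an ideal over \<open>T\<close> maximal with respect to avoiding a sequence
  \<open>a, a r\<^sub>0 a, \<dots>\<close>; any ideal that contains a term of this sequence contains all later terms.\<close>

lemma prime_ideal_avoiding:
  fixes T :: "'a::ring set"
  assumes T: "semiprime_ideal T" and a: "a \<notin> T"
  obtains P where "prime_ideal P" "T \<subseteq> P" "a \<notin> P"
proof -
  have idT: "two_sided_ideal T" and spr: "\<And>a. a \<notin> T \<Longrightarrow> \<exists>r. a * r * a \<notin> T"
    using T unfolding semiprime_ideal_def by blast+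
  then obtain r where r: "\<And>a. a \<notin> T \<Longrightarrow> a * r a * a \<notin> T"
    by metis
  define s where "s = rec_nat a (\<lambda>_ b. b * r b * b)"
  have s0: "s 0 = a" and sSuc: "s (Suc n) = s n * r (s n) * s n" for n
    by (simp_all add: s_def)
  have sT: "s n \<notin> T" for n
    by (induction n) (simp_all add: s0 sSuc a r)
  have s_mono: "s n \<in> Q" if "two_sided_ideal Q" "s m \<in> Q" "m \<le> n" for Q m n
    using that(3,2) by (induction rule: dec_induct) (simp_all add: sSuc ideal_mult_left that(1))
  define \<A> where "\<A> = {Q. two_sided_ideal Q \<and> T \<subseteq> Q \<and> (\<forall>n. s n \<notin> Q)}"
  have "\<exists>P\<in>\<A>. \<forall>Q\<in>\<A>. P \<subseteq> Q \<longrightarrow> Q = P"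
  proof (rule subset_Zorn_nonempty)
    show "\<A> \<noteq> {}" using idT sT by (auto simp: \<A>_def)
    fix C assume C: "C \<noteq> {}" "subset.chain \<A> C"
    then have CA: "C \<subseteq> \<A>" and lin: "\<And>X Y. X \<in> C \<Longrightarrow> Y \<in> C \<Longrightarrow> X \<subseteq> Y \<or> Y \<subseteq> X"
      by (auto simp: subset_chain_def)
    have "x - y \<in> \<Union>C" if xy: "x \<in> \<Union>C" "y \<in> \<Union>C" for x y
    proof -
      obtain X Y where "X \<in> C" "Y \<in> C" "x \<in> X" "y \<in> Y" using xy by blast
      then obtain Z where "Z \<in> C" "x \<in> Z" "y \<in> Z" using lin by blast
      then show ?thesis using CA by (auto simp: \<A>_def intro: ideal_diff)
    qed
    moreover have "0 \<in> \<Union>C" using C(1) CA by (auto simp: \<A>_def intro: ideal_0)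
    moreover have "r * x \<in> \<Union>C \<and> x * r \<in> \<Union>C" if "x \<in> \<Union>C" for x r
      using that CA by (auto simp: \<A>_def intro: ideal_mult_left ideal_mult_right)
    ultimately have "two_sided_ideal (\<Union>C)" by (simp add: two_sided_ideal_def)
    then show "\<Union>C \<in> \<A>" using C(1) CA unfolding \<A>_def by blast
  qed
  then obtain P where P: "P \<in> \<A>" and max: "\<And>Q. Q \<in> \<A> \<Longrightarrow> P \<subseteq> Q \<Longrightarrow> Q = P" by blast
  have idP: "two_sided_ideal P" and TP: "T \<subseteq> P" and sP: "\<And>n. s n \<notin> P"
    using P by (auto simp: \<A>_def)
  have meets: "\<exists>n. s n \<in> Q" if "two_sided_ideal Q" "P \<subseteq> Q" "x \<in> Q" "x \<notin> P" for Q x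
    using that max[of Q] TP by (auto simp: \<A>_def)
  have "b \<in> P \<or> c \<in> P" if bc: "\<And>x. b * x * c \<in> P" for b c
  proof (rule ccontr)
    assume "\<not> (b \<in> P \<or> c \<in> P)"
    then have bP: "b \<notin> P" and cP: "c \<notin> P" by auto
    \<comment> \<open>\<open>B\<close> and, below, \<open>C\<close> are annihilators modulo
      \<open>P\<close>. They contain \<open>c\<close> and \<open>b\<close>, so they exceed
      \<open>P\<close> and by maximality meet the sequence \<open>s\<close>.\<close>
    define B where "B = {y. \<forall>x. b * x * y \<in> P}"
    have "b * x * (z * y) \<in> P" "b * x * (y * z) \<in> P" if "y \<in> B" for x y z
    proof -
      have "b * (x * z) * y \<in> P" "b * x * y \<in> P" using that by (auto simp: B_def)
      then show "b * x * (z * y) \<in> P" "b * x * (y * z) \<in> P"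
        using ideal_mult_right[OF idP, of "b * x * y" z] by (simp_all add: mult.assoc)
    qed
    then have "two_sided_ideal B"
      unfolding two_sided_ideal_def
      by (simp add: B_def right_diff_distrib ideal_0[OF idP] ideal_diff[OF idP])
    moreover have "P \<subseteq> B" by (auto simp: B_def ideal_mult_left[OF idP])
    ultimately obtain m where m: "s m \<in> B" using meets[of B c] bc cP by (auto simp: B_def)
    define C where "C = {x. \<forall>z. \<forall>y\<in>B. x * z * y \<in> P}"
    have "z * x * t * y \<in> P" "x * z * t * y \<in> P" if "x \<in> C" "y \<in> B" for x y z t
    proof -
      have "x * (z * t) * y \<in> P" "x * t * y \<in> P" using that by (auto simp: C_def)
      then show "z * x * t * y \<in> P" "x * z * t * y \<in> P"
        using ideal_mult_left[OF idP, of "x * t * y" z] by (simp_all add: mult.assoc)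
    qed
    then have "two_sided_ideal C"
      unfolding two_sided_ideal_def
      by (simp add: C_def left_diff_distrib ideal_0[OF idP] ideal_diff[OF idP])
    moreover have "P \<subseteq> C" by (auto simp: C_def ideal_mult_right[OF idP])
    moreover have "b \<in> C" by (auto simp: C_def B_def)
    ultimately obtain n where n: "s n \<in> C" using meets[of C b] bP by auto
    \<comment> \<open>A term past both indices lies in \<open>B\<close> and in \<open>C\<close>, so
      its successor falls into \<open>P\<close>.\<close>
    have "s (max m n) \<in> B" "s (max m n) \<in> C"
      using s_mono \<open>two_sided_ideal B\<close> m \<open>two_sided_ideal C\<close> n by (meson max.cobounded1 max.cobounded2)+
    then have "s (Suc (max m n)) \<in> P" by (auto simp: sSuc C_def)
    then show False using sP by blast
  qed
  then have "prime_ideal P" using idP by (auto simp: prime_ideal_def)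
  moreover have "a \<notin> P" using sP[of 0] by (simp add: s0)
  ultimately show thesis using that TP by blast
qed

section \<open>The identity modulo a prime ideal\<close>

text \<open>\<open>h\<close> models reduction modulo a prime. \<open>d\<close> stays on the source
  ring because it may fail to induce a map on the quotient. Primeness is tested with middle factors
  from \<open>I\<close> alone.\<close>

locale prime_image_derivation =
  fixes h :: "'a::ring \<Rightarrow> 'b::ring" and d :: "'a \<Rightarrow> 'a" and I :: "'a set"
  assumes h_add: "h (x + y) = h x + h y"
    and h_mult: "h (x * y) = h x * h y"
    and d_add: "d (x + y) = d x + d y"
    and d_mult: "d (x * y) = d x * y + x * d y"
    and ideal: "two_sided_ideal I"
    and prime: "(\<And>y. y \<in> I \<Longrightarrow> h a * h y * h b = 0) \<Longrightarrow> h a = 0 \<or> h b = 0"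
    and identity: "x \<in> I \<Longrightarrow> (h (d x) * h x - h x * h (d x)) * h (d x) = 0"
begin

abbreviation D :: "'a \<Rightarrow> 'b" where "D x \<equiv> h (d x)"

section \<open>Polarization and primeness\<close>

definition mixed :: "'a \<Rightarrow> 'a \<Rightarrow> 'b"
  where "mixed x y = D x * h y - h y * D x + (D y * h x - h x * D y)"

definition cubic :: "'a \<Rightarrow> 'b" where "cubic x = (D x * h x - h x * D x) * D x"

text \<open>The full polarization of \<open>cubic\<close>: \<open>mixed\<close> is symmetric, so
  three cyclic terms cover all six orders.\<close>

definition trilinear :: "'a \<Rightarrow> 'a \<Rightarrow> 'a \<Rightarrow> 'b"
  where "trilinear x y z = mixed x y * D z + mixed y z * D x + mixed z x * D y"

lemma h_0 [simp]: "h 0 = 0" using h_add[of 0 0] by simp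
lemma d_0 [simp]: "d 0 = 0" using d_add[of 0 0] by simp
lemma h_minus: "h (- x) = - h x" using h_add[of x "- x"] by (simp add: eq_neg_iff_add_eq_0 add.commute)
lemma d_minus: "d (- x) = - d x" using d_add[of x "- x"] by (simp add: eq_neg_iff_add_eq_0 add.commute)
lemma h_diff: "h (x - y) = h x - h y" using h_add[of x "- y"] by (simp add: h_minus)

lemma d_diff: "d (x - y) = d x - d y" using d_add[of x "- y"] by (simp add: d_minus)

lemmas expand = h_add h_mult d_add d_mult h_minus d_minus h_diff d_diff

lemma I_closed: "x \<in> I \<Longrightarrow> x * r \<in> I" "x \<in> I \<Longrightarrow> r * x \<in> I"
  "x \<in> I \<Longrightarrow> y \<in> I \<Longrightarrow> x + y \<in> I" "x \<in> I \<Longrightarrow> y \<in> I \<Longrightarrow> x - y \<in> I" "x \<in> I \<Longrightarrow> - x \<in> I"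
  using ideal by (simp_all add: ideal_mult_left ideal_mult_right ideal_add ideal_diff ideal_minus)

lemma range_closed: "h x \<in> range h" "a \<in> range h \<Longrightarrow> b \<in> range h \<Longrightarrow> a * b \<in> range h"
  "a \<in> range h \<Longrightarrow> b \<in> range h \<Longrightarrow> a + b \<in> range h"
  "a \<in> range h \<Longrightarrow> b \<in> range h \<Longrightarrow> a - b \<in> range h" "a \<in> range h \<Longrightarrow> - a \<in> range h"
  by (auto simp flip: h_mult h_add h_diff h_minus)

text \<open>Cancellation for compound expressions, right-nested to match the normal form under
  \<open>mult.assoc\<close>.\<close>

lemma primeD:
  assumes "a \<in> range h" "b \<in> range h" "\<And>y. y \<in> I \<Longrightarrow> a * (h y * b) = 0"
  shows "a = 0 \<or> b = 0"
proof -
  obtain a' b' where "a = h a'" "b = h b'" using assms by blast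
  then show ?thesis using assms(3) prime[of a' b'] by (simp add: mult.assoc)
qed

lemma cubic_0: "x \<in> I \<Longrightarrow> cubic x = 0"
  using identity by (simp add: cubic_def)

lemma trilinear_0:
  assumes "x \<in> I" "y \<in> I" "z \<in> I"
  shows "trilinear x y z = 0"
proof -
  have "trilinear x y z = cubic (x + y + z) - cubic (x + y) - cubic (y + z) - cubic (x + z) + cubic x + cubic y + cubic z"
    by (simp add: trilinear_def mixed_def cubic_def expand algebra_simps)
  then show ?thesis using assms by (simp add: cubic_0 I_closed)
qed

text \<open>Over \<open>\<int>/2\<close> the polarization of a quadratic polynomial does not separate its homogeneous
  components, so the vanishing of one of the factors has to be extracted by hand.\<close>

lemma sandwich:
  assumes r: "a \<in> range h" "b \<in> range h" "c \<in> range h"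
    and 0: "\<And>s. s \<in> I \<Longrightarrow> a * (h s * (b * (h s * c))) = 0"
  shows "a = 0 \<or> b = 0 \<or> c = 0"
proof (rule ccontr)
  assume nz: "\<not> (a = 0 \<or> b = 0 \<or> c = 0)"
  obtain c' where c': "c = h c'" using r by auto
  have polar: "a * (h s * (b * (h t * c))) + a * (h t * (b * (h s * c))) = 0" if "s \<in> I" "t \<in> I" for s t
    using 0[of "s + t"] 0[of s] 0[of t] that by (simp add: expand algebra_simps I_closed)
  have alt: "a * (h s * c) = 0 \<or> b * (h s * c) = 0" if s: "s \<in> I" for s
  proof (rule primeD)
    fix t assume t: "t \<in> I"
    have "s * c' * t \<in> I" using s by (simp add: I_closed)
    from polar[OF s this]
    have "a * (h s * (b * (h s * c))) * h t * c + a * (h s * c) * (h t * (b * (h s * c))) = 0"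
      by (simp add: expand c' mult.assoc)
    then show "a * (h s * c) * (h t * (b * (h s * c))) = 0"
      by (simp add: 0[OF s])
  qed (use r in \<open>auto intro!: range_closed\<close>)
  obtain s t where "s \<in> I" "a * (h s * c) \<noteq> 0" "t \<in> I" "b * (h t * c) \<noteq> 0"
    using primeD[of a c] primeD[of b c] r nz by blast
  then show False
    using alt[of s] alt[of t] alt[of "s + t"] by (simp add: expand algebra_simps I_closed)
qed

text \<open>A factor 2 moves across products, so one nonzero 2-torsion element forces 2 to
  annihilate the whole image.\<close>

lemma two_torsion: "(\<forall>a. h a + h a = 0) \<or> (\<forall>a. h a + h a = 0 \<longrightarrow> h a = 0)"
proof (rule ccontr)
  assume "\<not> ?thesis"
  then obtain a b where ab: "h a + h a \<noteq> 0" "h b + h b = 0" "h b \<noteq> 0" by blast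
  have "h b = 0 \<or> h a + h a = 0"
  proof (rule primeD)
    fix y
    have "h b * (h y * (h a + h a)) = (h b + h b) * (h y * h a)" by (simp add: algebra_simps)
    then show "h b * (h y * (h a + h a)) = 0" by (simp add: ab)
  qed (auto intro!: range_closed)
  then show False using ab by blast
qed

end

section \<open>Square-zero elements\<close>

text \<open>Since \<open>d\<close> need not preserve the kernel of \<open>h\<close>, the vanishing of \<open>h (d (w * w))\<close> does not follow
  from that of \<open>h (w * w)\<close>.\<close>

locale square_zero = prime_image_derivation +
  fixes w
  assumes w: "w \<in> I" and ww: "h w * h w = 0" and w0: "h w \<noteq> 0"
    and d_ww: "h (d (w * w)) = 0"
begin

lemma ww': "h w * (h w * a) = 0"
  by (simp add: ww flip: mult.assoc)

lemma vw: "D w * h w = - (h w * D w)"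
  using d_ww by (simp add: expand eq_neg_iff_add_eq_0)

lemma vw': "D w * (h w * a) = - (h w * (D w * a))"
  by (simp add: vw flip: mult.assoc)

lemma wI: "w * r \<in> I" "r * w \<in> I" by (simp_all add: w I_closed)

text \<open>Write \<open>v\<close> for \<open>D w\<close>. Trilinear identities at multiples of
  \<open>w\<close> yield \<open>v v = 0\<close>, then rules for \<open>w D x w\<close>,
  \<open>w D x v\<close> and \<open>v D x w\<close>, and at last \<open>w x v y v = 0\<close>, which
  primeness excludes for nonzero \<open>v\<close>.\<close>

lemma D_eq_0_if_wDw:
  assumes k: "h w * D w = 0"
  shows "D w = 0"
proof (rule ccontr)
  assume v0: "D w \<noteq> 0"
  have k': "h w * (D w * a) = 0" for a
    by (simp add: k flip: mult.assoc)
  note R = ww ww' vw vw' k k'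
  have "h w * (h y * (D w * D w * (h z * h w))) = 0" if "y \<in> I" for y z
  proof -
    have "h w * (h y * (D w * D w * (h z * h w))) = - (h w * trilinear w y (w * z) * h w)"
      by (simp add: trilinear_def mixed_def expand algebra_simps R)
    then show ?thesis using trilinear_0[of w y "w * z"] that w wI by simp
  qed
  then have "D w * D w * (h z * h w) = 0" for z
    using primeD[of "h w" "D w * D w * (h z * h w)"] w0 by (auto intro!: range_closed)
  then have vv: "D w * D w = 0"
    using primeD[of "D w * D w" "h w"] w0 by (auto intro!: range_closed)
  have vv': "D w * (D w * a) = 0" for a
    by (simp add: vv flip: mult.assoc)
  have N: "h w * (D x * (h w * (h y * D w))) - h w * (h x * (D w * (h y * D w)))
      - h w * (h x * (h w * (D y * D w))) = 0" (is "?N x y = 0") if "x \<in> I" for x y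
  proof -
    have "?N x y = h w * trilinear w x (w * y)"
      by (simp add: trilinear_def mixed_def expand algebra_simps R vv vv')
    then show ?thesis using trilinear_0[of w x "w * y"] that w wI by simp
  qed
  have eta: "h w * (D x * h w) = - (h w * (h x * D w))" if x: "x \<in> I" for x
  proof -
    \<comment> \<open>\<open>N\<close> at \<open>x w s\<close>, minus \<open>w x\<close> times
      \<open>N\<close> at \<open>s\<close>, has the desired sum as a left factor.\<close>
    have "(h w * (D x * h w) + h w * (h x * D w)) * (h s * (h w * (h y * D w))) = 0"
      if s: "s \<in> I" for s y
    proof -
      have "(h w * (D x * h w) + h w * (h x * D w)) * (h s * (h w * (h y * D w)))
         = ?N (x * w * s) y - h w * h x * ?N s y"
        by (simp add: expand algebra_simps R)
      then show ?thesis using N[of "x * w * s" y] N[of s y] s by (simp add: I_closed)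
    qed
    then have "h w * (D x * h w) + h w * (h x * D w) = 0 \<or> h w * (h y * D w) = 0" for y
      by (intro primeD) (auto intro!: range_closed)
    moreover obtain y where "h w * (h y * D w) \<noteq> 0"
      using primeD[of "h w" "D w"] w0 v0 by (auto intro: range_closed)
    ultimately show ?thesis by (metis eq_neg_iff_add_eq_0)
  qed
  have eta': "h w * (D x * (h w * a)) = - (h w * (h x * (D w * a)))" if "x \<in> I" for x a
    using eta[OF that] by (metis mult.assoc mult_minus_left)
  have wDv: "h w * (D y * D w) = - (D w * (h y * D w)) - D w * (h y * D w)" for y
  proof -
    have "h w * (h x * (h w * (D y * D w) + D w * (h y * D w) + D w * (h y * D w))) = 0" if "x \<in> I" for x
    proof -
      have "h w * (h x * (h w * (D y * D w) + D w * (h y * D w) + D w * (h y * D w))) = - ?N x y"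
        by (simp add: algebra_simps eta'[OF that])
      then show ?thesis using N[OF that] by simp
    qed
    then have "h w * (D y * D w) + D w * (h y * D w) + D w * (h y * D w) = 0"
      using primeD[of "h w" "h w * (D y * D w) + D w * (h y * D w) + D w * (h y * D w)"] w0
      by (auto intro!: range_closed)
    then show ?thesis by (simp add: algebra_simps eq_neg_iff_add_eq_0)
  qed
  have wDv': "h w * (D y * (D w * a)) = - (D w * (h y * (D w * a))) - D w * (h y * (D w * a))" for y a
    using arg_cong[OF wDv[of y], of "\<lambda>t. t * a"] by (simp add: algebra_simps)
  have vDw: "D w * (D y * h w) = - (D w * (h y * D w))" if y: "y \<in> I" for y
  proof -
    have "h w * (h x * (D w * (D y * h w) + D w * (h y * D w))) = 0" if "x \<in> I" for x
      using eta'[OF that, of "D y * h w"] eta'[OF that, of "h y * D w"] eta[OF y]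
      by (simp add: algebra_simps)
    then have "D w * (D y * h w) + D w * (h y * D w) = 0"
      using primeD[of "h w" "D w * (D y * h w) + D w * (h y * D w)"] w0
      by (auto intro!: range_closed)
    then show ?thesis by (simp add: eq_neg_iff_add_eq_0)
  qed
  have e: "h w * (h x * (D w * (h y * D w))) =
      D w * (h x * (D w * (h y * h w))) + D w * (h x * (D w * (h y * h w)))" if x: "x \<in> I" and y: "y \<in> I" for x y
  proof -
    let ?e = "D w * (h x * (D w * (h y * h w))) + D w * (h x * (D w * (h y * h w)))
      - h w * (h x * (D w * (h y * D w)))"
    have "h w * (h z * ?e) = 0" if "z \<in> I" for z
    proof -
      have "h w * (h z * ?e) = h w * trilinear x (z * w) (w * y) * h w"
        by (simp add: trilinear_def mixed_def expand algebra_simps R vv vv' eta eta' wDv wDv' vDw x y that)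
      then show ?thesis using trilinear_0[of x "z * w" "w * y"] x wI by simp
    qed
    then have "?e = 0"
      using primeD[of "h w" ?e] w0 by (auto intro!: range_closed)
    then show ?thesis by simp
  qed
  have comm: "h w * (h x * D w) = D w * (h x * h w)" if x: "x \<in> I" for x
  proof -
    \<comment> \<open>\<open>e\<close> at \<open>x v y\<close> and \<open>v x\<close> times
      \<open>e\<close> at \<open>y\<close> have equal right-hand sides.\<close>
    have "(h w * (h x * D w) - D w * (h x * h w)) * (h y * (D w * (h z * D w))) = 0" if "y \<in> I" "z \<in> I" for y z
      using e[of "x * d w * y" z] e[of y z] x that by (simp add: expand algebra_simps I_closed)
    then have "h w * (h x * D w) - D w * (h x * h w) = 0 \<or> D w * (h z * D w) = 0" if "z \<in> I" for z
      using that by (intro primeD) (auto intro!: range_closed)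
    moreover obtain z where "z \<in> I" "D w * (h z * D w) \<noteq> 0"
      using primeD[of "D w" "D w"] v0 by (auto intro: range_closed)
    ultimately show ?thesis by auto
  qed
  have "h w * (h x * (D w * (h y * D w))) = 0" if "x \<in> I" "y \<in> I" for x y
  proof -
    \<comment> \<open>By \<open>comm\<close> the left side of \<open>e\<close> is
      \<open>v x v y w\<close>, while \<open>e\<close> makes it twice that element.\<close>
    have "h w * (h x * (D w * (h y * D w))) = D w * (h x * (h w * (h y * D w)))"
      using comm[OF that(1)] by (metis mult.assoc)
    then show ?thesis using e[OF that] by (simp add: comm[OF that(2)])
  qed
  then show False
    using primeD[of "h w" "D w * (h y * D w)" for y] primeD[of "D w" "D w"] v0 w0
    by (metis range_closed(1,2) rangeI)
qed

text \<open>As \<open>D w = 0\<close>, adding \<open>w\<close> to \<open>y\<close> changes only the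
  second entry of the commutator. So \<open>?c y\<close>, the commutator of \<open>D y\<close> and
  \<open>w\<close>, satisfies \<open>?c y * D y = 0\<close>; polarizing leads to
  \<open>w D z w = 0\<close> and then \<open>D x w = 0\<close>.\<close>

lemma D_eq_0_if_Dw:
  assumes v: "D w = 0" and x: "x \<in> I"
  shows "D x = 0"
proof -
  note R = ww ww' v
  let ?c = "\<lambda>y. D y * h w - h w * D y"
  have c: "?c y * D y = 0" if "y \<in> I" for y
  proof -
    have "?c y * D y = cubic (w + y) - cubic y"
      by (simp add: cubic_def expand algebra_simps R)
    then show ?thesis using cubic_0 that w I_closed by simp
  qed
  have c2: "?c y * D z + ?c z * D y = 0" if "y \<in> I" "z \<in> I" for y z
    using c[of "y + z"] c[of y] c[of z] that by (simp add: expand algebra_simps I_closed)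
  have cc: "?c y * ?c z = 0" if "y \<in> I" "z \<in> I" for y z
  proof -
    \<comment> \<open>Compare \<open>c2\<close> times \<open>w\<close> with \<open>c2\<close> at
      \<open>y * w\<close>, using \<open>?c (y * w) = ?c y * h w\<close>.\<close>
    have "?c y * ?c z = (?c z * D y + ?c y * D z) * h w - (?c z * D (y * w) + ?c (y * w) * D z)"
      by (simp add: expand algebra_simps R)
    then show ?thesis using c2[of z y] c2[of z "y * w"] that by (simp add: I_closed)
  qed
  have T: "h w * (D y * (h w * (D z * h w))) = 0" if "y \<in> I" "z \<in> I" for y z
  proof -
    have "h w * (D y * (h w * (D z * h w))) = h w * (?c y * ?c z)"
      by (simp add: algebra_simps R)
    then show ?thesis using cc[OF that] by simp
  qed
  have wDw: "h w * (D z * h w) = 0" if z: "z \<in> I" for z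
  proof -
    have "h w * (D z * h w) * (h r * (h w * (D z * h w))) = 0" if r: "r \<in> I" for r
      using T[of "z * w * r" z] T[of r z] z r by (simp add: expand algebra_simps R I_closed)
    then show ?thesis
      using primeD[of "h w * (D z * h w)" "h w * (D z * h w)"] by (auto intro!: range_closed)
  qed
  have wDw': "h w * (D z * (h w * a)) = 0" if "z \<in> I" for z a
    using wDw[OF that] by (metis mult.assoc mult_zero_left)
  have wDDw: "h w * (D y * (D z * h w)) = 0" if "y \<in> I" "z \<in> I" for y z
  proof -
    have "h w * (D y * (D z * h w)) = - (?c y * ?c z)
        + h w * (D y * h w) * D z + D y * (h w * (D z * h w))"
      by (simp add: algebra_simps R)
    then show ?thesis using cc[OF that] wDw that by simp
  qed
  have Dw: "D x * h w = 0" if x: "x \<in> I" for x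
  proof (rule ccontr)
    assume nz: "D x * h w \<noteq> 0"
    let ?q = "D x * (D x * h w) + D x * (D x * h w)"
    have q: "D x * (h w * (h y * (D x * h w))) = h w * (h y * ?q)" if y: "y \<in> I" for y
    proof -
      have "w * y \<in> I" "x + w * y \<in> I" "y * x \<in> I" using wI x y by (simp_all add: I_closed)
      then have "cubic (x + w * y) * h w - cubic x * h w - cubic (w * y) * h w = 0"
        using x by (simp add: cubic_0)
      moreover have "h w * (D y * (h x * (D x * h w))) = - (h w * (h y * (D x * (D x * h w))))"
        using wDDw[OF \<open>y * x \<in> I\<close> x] by (simp add: expand algebra_simps eq_neg_iff_add_eq_0)
      ultimately show ?thesis
        by (simp add: cubic_def expand algebra_simps R wDw wDw' wDDw x y)
    qed
    have "(D x * (h w * (h y * h w)) - h w * (h y * (D x * h w))) * (h z * ?q) = 0"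
      if "y \<in> I" "z \<in> I" for y z
    proof -
      \<comment> \<open>Two evaluations of \<open>D x w y D x w z D x w\<close>: by \<open>q\<close>
        at \<open>z\<close> and by \<open>q\<close> at \<open>y (D x) w z\<close>.\<close>
      have "D x * (h w * (h y * (h w * (h z * ?q)))) = h w * (h y * (D x * (h w * (h z * ?q))))"
        using q[of z] q[of "y * d x * w * z"] that by (simp add: expand mult.assoc I_closed)
      then show ?thesis by (simp add: left_diff_distrib mult.assoc)
    qed
    then have alt: "D x * (h w * (h y * h w)) - h w * (h y * (D x * h w)) = 0 \<or> ?q = 0" if "y \<in> I" for y
      using that by (intro primeD) (auto intro!: range_closed)
    have "?q = 0"
    proof (rule ccontr)
      assume "?q \<noteq> 0"
      then have comm: "D x * (h w * (h y * h w)) = h w * (h y * (D x * h w))" if "y \<in> I" for y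
        using alt[OF that] by simp
      have "h w * (h y * (D x * (D x * h w))) = 0" if "y \<in> I" for y
        using comm[of "y * d x"] q[of y] that by (simp add: expand algebra_simps I_closed)
      then have "D x * (D x * h w) = 0"
        using primeD[of "h w" "D x * (D x * h w)"] w0 by (auto intro!: range_closed)
      then show False using \<open>?q \<noteq> 0\<close> by simp
    qed
    then have "D x * h w * (h y * (D x * h w)) = 0" if "y \<in> I" for y
      using q[OF that] by (simp add: mult.assoc)
    then show False using primeD[of "D x * h w" "D x * h w"] nz by (auto intro!: range_closed)
  qed
  have "D x * (h s * h w) = 0" if "s \<in> I" for s
    using Dw[of "x * s"] Dw[of s] x that by (simp add: expand algebra_simps I_closed)
  then show ?thesis
    using primeD[of "D x" "h w"] w0 by (auto intro!: range_closed)
qed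

text \<open>The signs in \<open>w + w y\<close> and \<open>w - w y\<close> isolate twice the
  component of degree (2, 1), which after multiplication by \<open>w\<close> is \<open>k y k\<close>
  with \<open>k = w D w\<close>.\<close>

lemma wDw_torsion_free:
  assumes tf: "\<And>a. h a + h a = 0 \<Longrightarrow> h a = 0"
  shows "h w * D w = 0"
proof -
  note R = ww ww' vw vw'
  have "h w * D w * (h y * (h w * D w)) = 0" if y: "y \<in> I" for y
  proof -
    have "cubic (w + w * y) - cubic (w - w * y) - cubic (w * y) - cubic (w * y) = 0"
      using y w by (simp add: cubic_0 I_closed)
    then have "h w * (cubic (w + w * y) - cubic (w - w * y) - cubic (w * y) - cubic (w * y)) = 0" by simp
    moreover have "h w * (cubic (w + w * y) - cubic (w - w * y) - cubic (w * y) - cubic (w * y))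
        = h (w * d w * y * w * d w) + h (w * d w * y * w * d w)"
      by (simp add: cubic_def expand algebra_simps R)
    ultimately have "h (w * d w * y * w * d w) = 0"
      using tf by simp
    then show ?thesis by (simp add: expand mult.assoc)
  qed
  then show ?thesis using primeD[of "h w * D w" "h w * D w"] by (auto intro!: range_closed)
qed

text \<open>With \<open>k = w D w\<close> and \<open>\<theta> z = k z + w z D w\<close>, the identity at \<open>w + w y\<close> reads \<open>k y k = k y \<theta> y\<close>, while
  its trilinear part forces \<open>\<theta> y y \<theta> z = 0\<close>. Together they give \<open>k y k y k = 0\<close>.\<close>

lemma wDw_char_2:
  assumes two: "\<And>a. h a + h a = 0"
  shows "h w * D w = 0"
proof (rule ccontr)
  let ?k = "h w * D w"
  assume k0: "?k \<noteq> 0"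
  have neg: "- h a = h a" for a
    using two[of a] by (simp add: neg_eq_iff_add_eq_0)
  have eqI: "a = b" if "a + b = 0" "b \<in> range h" for a b
    using that neg by (auto simp: add_eq_0_iff2)
  have two1: "h a * t + h a * t = 0" for a t
    using two[of a] by (simp flip: distrib_right)
  have two2: "h a + (h a + t) = t" "h a * s + (h a * s + t) = t" for a s t
    using two two1 by (simp_all flip: add.assoc)
  have minus: "t - h a = t + h a" "t - h a * s = t + h a * s" "- (h a * s) = h a * s" for a s t
    using neg by (simp_all add: add_uminus_conv_diff [symmetric] minus_mult_left del: add_uminus_conv_diff)
  have vw2: "D w * h w = h w * D w" "D w * (h w * a) = h w * (D w * a)" for a
    using vw vw' minus by simp_all
  note R = ww ww' vw2 neg minus two two1 two2 distrib_left distrib_right left_diff_distrib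
    right_diff_distrib mult.assoc add_ac
  \<comment> \<open>\<open>t\<close> takes values in the source ring so that \<open>t y\<close> can
    be substituted into arguments of \<open>h\<close> and \<open>t\<close>.\<close>
  define t where "t z = w * d w * z + w * z * d w" for z
  let ?\<theta> = "\<lambda>z. h (t z)"
  have h_t: "?\<theta> z = h w * (D w * h z) + h w * (h z * D w)" for z
    by (simp add: t_def expand mult.assoc)
  have V: "?k * (h y * ?k) + ?k * (h y * ?\<theta> y) = 0" for y
  proof -
    have "?k * (h y * ?k) + ?k * (h y * ?\<theta> y) = h w * (cubic (w + w * y) - cubic (w * y))"
      by (simp add: cubic_def t_def expand R)
    then show ?thesis using cubic_0 wI w I_closed by simp
  qed
  \<comment> \<open>\<open>k y k\<close> is additive in \<open>y\<close>, so polarizing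
    \<open>V\<close> leaves only the terms with \<open>\<theta>\<close>.\<close>
  have sym: "?k * (h y * ?\<theta> z) = ?k * (h z * ?\<theta> y)" for y z
  proof (rule eqI)
    have "?k * (h y * ?\<theta> z) + ?k * (h z * ?\<theta> y) =
       (?k * (h (y + z) * ?k) + ?k * (h (y + z) * ?\<theta> (y + z)))
       - (?k * (h y * ?k) + ?k * (h y * ?\<theta> y)) - (?k * (h z * ?k) + ?k * (h z * ?\<theta> z))"
      by (simp add: t_def expand R)
    then show "?k * (h y * ?\<theta> z) + ?k * (h z * ?\<theta> y) = 0" by (simp add: V)
  qed (intro range_closed)
  have double: "a + a = 0" if "a \<in> range h" for a
    using that two by auto
  \<comment> \<open>This is \<open>\<theta> (z w) = 0\<close>: \<open>sym\<close> brings
    \<open>w\<close> in front of \<open>\<theta> y\<close>, which it annihilates.\<close>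
  have kw: "?k * (h z * h w) = h w * (h z * ?k)" for z
  proof (rule eqI)
    have "?k * (h y * (?k * (h z * h w) + h w * (h z * ?k))) = 0" for y
      using sym[of y "z * w"] by (simp add: t_def expand R ww')
    then show "?k * (h z * h w) + h w * (h z * ?k) = 0"
      using primeD[of ?k "?k * (h z * h w) + h w * (h z * ?k)"] k0 by (auto intro!: range_closed)
  qed (intro range_closed)
  have kw': "?k * (h z * (h w * a)) = h w * (h z * (?k * a))" for z a
    using kw[of z] by (metis mult.assoc)
  have \<theta>_comm: "?\<theta> y * (D w * h y) + ?\<theta> y * (h y * D w) = 0" if y: "y \<in> I" for y
  proof -
    have J: "h w * (D y * ?\<theta> y) + h w * (h y * ?\<theta> (d y))
        + (?\<theta> y * (D w * h y) + ?\<theta> y * (h y * D w)) = 0" (is "_ + ?c = 0")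
    proof -
      have "h w * (D y * ?\<theta> y) + h w * (h y * ?\<theta> (d y)) + ?c = h w * trilinear w y (w * y)"
        by (simp add: trilinear_def mixed_def t_def expand R)
      then show ?thesis using trilinear_0[of w y "w * y"] w wI y by simp
    qed
    \<comment> \<open>Multiplied by \<open>k p\<close>, the two terms of \<open>J\<close> with
      derivatives of \<open>y\<close> become equal by \<open>kw'\<close> and \<open>sym\<close>, so
      they cancel in characteristic 2.\<close>
    have "?k * (h p * ?c) = 0" if "p \<in> I" for p
    proof -
      let ?a = "?k * (h p * (h w * (D y * ?\<theta> y)))" and ?b = "?k * (h p * (h w * (h y * ?\<theta> (d y))))"
      have "?a = ?b"
        unfolding kw' sym[of "d y" y] ..
      moreover have "?a + ?b + ?k * (h p * ?c) = 0"
        using arg_cong[OF J, of "\<lambda>r. ?k * (h p * r)"] by (simp only: distrib_left mult_zero_right)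
      moreover have "?b + ?b = 0"
        by (intro double range_closed)
      ultimately show ?thesis by simp
    qed
    then show ?thesis
      using primeD[of ?k ?c] k0 by (auto intro!: range_closed)
  qed
  have \<theta>_comm_w: "?\<theta> y * (D w * (h z * h w)) + ?\<theta> y * (h z * ?k) = 0" if y: "y \<in> I" and z: "z \<in> I" for y z
  proof -
    have \<theta>0: "?\<theta> (z * w) = 0"
      using kw[of z] two by (simp add: t_def expand mult.assoc) (metis two h_mult)
    \<comment> \<open>Adding \<open>z w\<close> to \<open>y\<close> leaves \<open>\<theta>\<close>
      unchanged, so in \<open>\<theta>_comm\<close> only the other factors change.\<close>
    have "?\<theta> (y + z * w) = ?\<theta> y + ?\<theta> (z * w)"
      by (simp add: t_def expand R)
    then have "?\<theta> (y + z * w) = ?\<theta> y"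
      using \<theta>0 by simp
    then have "?\<theta> (y + z * w) * (D w * h (y + z * w)) + ?\<theta> (y + z * w) * (h (y + z * w) * D w)
      = (?\<theta> y * (D w * h y) + ?\<theta> y * (h y * D w))
        + (?\<theta> y * (D w * (h z * h w)) + ?\<theta> y * (h z * ?k))"
      by (simp add: expand R)
    then show ?thesis
      using \<theta>_comm[of "y + z * w"] \<theta>_comm[OF y] y z by (simp add: I_closed)
  qed
  have \<theta>_v: "h w * (h p * (?\<theta> y * D w)) = ?k * (h p * ?\<theta> y)" if y: "y \<in> I" for p y
  proof (rule eqI)
    let ?e = "h w * (h p * (?\<theta> y * D w)) + ?k * (h p * ?\<theta> y)"
    have "?e * (h z * h w) = 0" if z: "z \<in> I" for z
    proof -
      have "?k * (h (p * t y * z) * h w) = h w * (h (p * t y * z) * ?k)" by (rule kw)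
      then have "?e * (h z * h w) = h w * (h p * (?\<theta> y * (D w * (h z * h w)) + ?\<theta> y * (h z * ?k)))"
        by (simp add: h_mult distrib_left distrib_right mult.assoc)
      then show ?thesis by (simp add: \<theta>_comm_w y z)
    qed
    then show "?e = 0" using primeD[of ?e "h w"] w0 by (auto intro!: range_closed)
  qed (intro range_closed)
  have \<theta>\<theta>: "?\<theta> y * (h y * ?\<theta> z) = 0" if y: "y \<in> I" for y z
  proof -
    have "?k * (h p * (?\<theta> y * (h y * ?\<theta> z))) = 0" for p
    proof -
      \<comment> \<open>\<open>\<theta>\<close> vanishes at \<open>p (t y) y\<close>, and
        \<open>sym\<close> exchanges this argument with \<open>z\<close>.\<close>
      have "?\<theta> (p * t y * y) = ?k * (h p * ?\<theta> y) * h y + h w * (h p * (?\<theta> y * (h y * D w)))"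
        unfolding h_t[of "p * t y * y"] by (simp add: h_mult mult.assoc)
      also have "\<dots> = h w * (h p * (?\<theta> y * (D w * h y) + ?\<theta> y * (h y * D w)))"
        unfolding \<theta>_v[OF y, of p, symmetric] by (simp add: distrib_left mult.assoc)
      also have "\<dots> = 0" by (simp add: \<theta>_comm[OF y])
      finally show ?thesis using sym[of "p * t y * y" z] by (simp add: expand mult.assoc)
    qed
    then show ?thesis
      using primeD[of ?k "?\<theta> y * (h y * ?\<theta> z)"] k0 by (auto intro!: range_closed)
  qed
  have "?k * (h y * (?k * (h y * ?k))) = 0" if y: "y \<in> I" for y
  proof -
    have V': "?k * (h y * ?k) = ?k * (h y * ?\<theta> y)"
      by (rule eqI[OF V]) (intro range_closed)
    have "?k * (h y * (?k * (h y * ?k))) = ?k * (h y * (?k * (h y * ?\<theta> y)))"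
      by (simp only: V')
    also have "\<dots> = ?k * (h y * ?k) * (h y * ?\<theta> y)"
      by (simp only: mult.assoc)
    also have "\<dots> = ?k * (h y * ?\<theta> y) * (h y * ?\<theta> y)"
      by (simp only: V')
    also have "\<dots> = ?k * (h y * (?\<theta> y * (h y * ?\<theta> y)))"
      by (simp only: mult.assoc)
    finally show ?thesis by (simp only: \<theta>\<theta>[OF y] mult_zero_right)
  qed
  then show False
    using sandwich[of ?k ?k ?k] k0 by (auto intro!: range_closed)
qed

lemma D_eq_0: "x \<in> I \<Longrightarrow> D x = 0"
  using two_torsion wDw_torsion_free wDw_char_2 D_eq_0_if_wDw D_eq_0_if_Dw by blast

end

section \<open>Kernel elements and the commuting property modulo a prime\<close>

context prime_image_derivation
begin

text \<open>For \<open>q\<close> in the kernel, \<open>D (q r) = D q * h r\<close>, so identities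
  for kernel elements extend to multiples. A nonzero \<open>D p\<close> can then be cancelled,
  leaving the image of \<open>I\<close> central.\<close>

lemma commutator_eq_0_if_kernel_not_invariant:
  assumes p: "p \<in> I" "h p = 0" "D p \<noteq> 0" and x: "x \<in> I"
  shows "h r * h x - h x * h r = 0"
proof -
  have j1: "(D q * h x - h x * D q) * D q + (D x * h x - h x * D x) * D q
      + (D q * h x - h x * D q) * D x = 0" (is "?l = 0")
    if "q \<in> I" "h q = 0" "x \<in> I" for q x
  proof -
    have "?l = cubic (x + q) - cubic x"
      using that by (simp add: cubic_def expand algebra_simps)
    then show ?thesis using cubic_0 that I_closed by simp
  qed
  have j2: "(D q * h x - h x * D q) * D s + (D s * h x - h x * D s) * D q = 0" (is "?l = 0")
    if "q \<in> I" "h q = 0" "s \<in> I" "h s = 0" "x \<in> I" for q s x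
  proof -
    have "?l = ((D (q + s) * h x - h x * D (q + s)) * D (q + s) + (D x * h x - h x * D x) * D (q + s)
      + (D (q + s) * h x - h x * D (q + s)) * D x)
      - ((D q * h x - h x * D q) * D q + (D x * h x - h x * D x) * D q + (D q * h x - h x * D q) * D x)
      - ((D s * h x - h x * D s) * D s + (D x * h x - h x * D x) * D s + (D s * h x - h x * D s) * D x)"
      by (simp add: expand algebra_simps)
    then show ?thesis
      using j1[of "q + s" x] j1[of q x] j1[of s x] that by (simp add: h_add I_closed)
  qed
  have j3: "(D q * h x - h x * D q) * D q = 0" if q: "q \<in> I" "h q = 0" and x: "x \<in> I" for q x
  proof -
    have l: "D s * ((D q * h x - h x * D q) * D q) = 0" if "s \<in> I" "h s = 0" for s
    proof -
      \<comment> \<open>\<open>j2\<close> at \<open>s * d q\<close>, minus \<open>j2\<close> at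
        \<open>s\<close> times \<open>D q\<close>, leaves a product with left factor
        \<open>D s\<close>.\<close>
      have "D s * ((D q * h x - h x * D q) * D q) =
          ((D q * h x - h x * D q) * D (s * d q) + (D (s * d q) * h x - h x * D (s * d q)) * D q)
          - ((D q * h x - h x * D q) * D s + (D s * h x - h x * D s) * D q) * D q"
        using that by (simp add: expand algebra_simps)
      then show ?thesis
        using j2[of q "s * d q" x] j2[of q s x] q x that by (simp add: h_mult I_closed)
    qed
    have "D p * (h y * ((D q * h x - h x * D q) * D q)) = 0" for y
      using l[of "p * y"] p by (simp add: expand I_closed mult.assoc)
    then show ?thesis
      using primeD[of "D p" "(D q * h x - h x * D q) * D q"] p by (auto intro!: range_closed)
  qed
  have j4: "D q * h x - h x * D q = 0" if q: "q \<in> I" "h q = 0" and x: "x \<in> I" for q x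
  proof -
    have "(D q * h x - h x * D q) * (h y * D q) = 0" if y: "y \<in> I" for y
    proof -
      have "(D q * h x - h x * D q) * (h y * D q)
          = (D q * h (x * y) - h (x * y) * D q) * D q - h x * ((D q * h y - h y * D q) * D q)"
        by (simp add: expand algebra_simps)
      then show ?thesis using j3 q x y by (simp add: I_closed)
    qed
    then have "D q * h x - h x * D q = 0 \<or> D q = 0"
      by (intro primeD) (auto intro!: range_closed)
    then show ?thesis by auto
  qed
  have j5: "D q * (h r * h x - h x * h r) = 0" if q: "q \<in> I" "h q = 0" for q
  proof -
    have "D q * (h r * h x - h x * h r) = (D (q * r) * h x - h x * D (q * r)) - (D q * h x - h x * D q) * h r"
      using q by (simp add: expand algebra_simps)
    then show ?thesis using j4[of "q * r" x] j4[of q x] q x by (simp add: h_mult I_closed)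
  qed
  have "D p * (h y * (h r * h x - h x * h r)) = 0" for y
    using j5[of "p * y"] p by (simp add: expand I_closed mult.assoc)
  then show ?thesis
    using primeD[of "D p" "h r * h x - h x * h r"] p by (auto intro!: range_closed)
qed

theorem commuting:
  assumes x: "x \<in> I"
  shows "D x * h x - h x * D x = 0"
proof (cases "\<exists>p\<in>I. h p = 0 \<and> D p \<noteq> 0")
  case True
  then show ?thesis using commutator_eq_0_if_kernel_not_invariant x by blast
next
  case False
  let ?c = "d x * x - x * d x"
  have cD: "h ?c * D x = 0" using cubic_0[OF x] by (simp add: cubic_def expand)
  show ?thesis
  proof (rule ccontr)
    assume c: "D x * h x - h x * D x \<noteq> 0"
    then have "D x \<noteq> 0" by auto
    then obtain s where s: "s \<in> I" and w0: "D x * (h s * h ?c) \<noteq> 0"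
      using primeD[of "D x" "h ?c"] c by (auto simp: expand intro: range_closed)
    let ?w = "d x * s * ?c"
    have w: "?w \<in> I" using s by (simp add: I_closed)
    have "h ?w * h ?w = D x * (h s * (h ?c * D x * (h s * h ?c)))"
      by (simp only: h_mult mult.assoc)
    then have ww: "h ?w * h ?w = 0" by (simp only: cD) simp
    interpret square_zero h d I ?w
    proof
      show "h ?w \<noteq> 0" using w0 by (simp only: h_mult mult.assoc not_False_eq_True)
      \<comment> \<open>In this case \<open>D\<close> vanishes on kernel elements of
        \<open>I\<close>, and the square of \<open>?w\<close> is one.\<close>
      have "?w * ?w \<in> I" "h (?w * ?w) = 0" using w ww by (simp_all only: I_closed h_mult)
      then show "h (d (?w * ?w)) = 0" using False by blast
    qed (fact w ww)+
    show False using D_eq_0[OF x] \<open>D x \<noteq> 0\<close> by simp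
  qed
qed

end

section \<open>From primes back to the semiprime ideal\<close>

lemma prime_ideal_commuting:
  fixes P :: "'a::ring set"
  assumes P: "prime_ideal P" and I: "two_sided_ideal I" and d: "derivation d"
    and id: "\<And>x. x \<in> I \<Longrightarrow> commutator (d x) x * d x \<in> P"
    and x: "x \<in> I"
  shows "commutator (d x) x \<in> P"
proof (cases "x \<in> P")
  case True
  then show ?thesis
    using P by (simp add: prime_ideal_def commutator_def ideal_diff ideal_mult_left ideal_mult_right)
next
  case False
  have idP: "two_sided_ideal P" and prP: "\<And>a b. (\<And>r. a * r * b \<in> P) \<Longrightarrow> a \<in> P \<or> b \<in> P"
    using P by (auto simp: prime_ideal_def)
  note coset_0 = coset_eq_0_iff[OF idP]
  have diff: "coset P (a - b) = coset P a - coset P b" for a b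
    using coset_add[of P "a - b" b] by simp
  interpret prime_image_derivation "coset P" d I
  proof
    fix a b
    assume "\<And>y. y \<in> I \<Longrightarrow> coset P a * coset P y * coset P b = 0"
    then have ab: "a * y * b \<in> P" if "y \<in> I" for y
      using that by (simp add: coset_0 flip: coset_mult)
    \<comment> \<open>As \<open>x\<close> is in \<open>I\<close> but not in \<open>P\<close>, middle
      factors \<open>r x s\<close> from \<open>I\<close> suffice; a second use of primality removes
      \<open>x\<close>.\<close>
    have "a * r * (x * s * b) \<in> P" for r s
      using ab[of "r * x * s"] x I by (simp add: ideal_mult_left ideal_mult_right mult.assoc)
    then have "a \<in> P \<or> x * s * b \<in> P" for s
      by (rule prP)
    then have "a \<in> P \<or> b \<in> P"
      using prP[of x b] False by blast
    then show "coset P a = 0 \<or> coset P b = 0"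
      by (simp add: coset_0)
  next
    fix x assume "x \<in> I"
    then have "coset P (commutator (d x) x * d x) = 0"
      using id by (simp add: coset_0)
    then show "(coset P (d x) * coset P x - coset P x * coset P (d x)) * coset P (d x) = 0"
      by (simp add: commutator_def coset_mult diff)
  qed (use d I in \<open>simp_all add: coset_add coset_mult derivation_def additive_def\<close>)
  have "coset P (commutator (d x) x) = 0"
    using commuting[OF x] by (simp add: commutator_def coset_mult diff)
  then show ?thesis by (simp add: coset_0)
qed

theorem theorem2p10:
  fixes I T :: "'a::ring set" and d :: "'a \<Rightarrow> 'a"
  assumes "two_sided_ideal I" and "I \<noteq> {0}"
    and "semiprime_ideal T" and "T \<subset> I"
    and "quotient_char T \<noteq> 2"
    and "derivation d"
    and "\<forall>x\<in>I. commutator (d x) x * d x \<in> T"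
  shows "commuting_mod T d I"
  unfolding commuting_mod_def
proof (intro ballI, rule ccontr)
  fix x assume x: "x \<in> I" "commutator (d x) x \<notin> T"
  then obtain P where P: "prime_ideal P" "T \<subseteq> P" "commutator (d x) x \<notin> P"
    using prime_ideal_avoiding[OF assms(3)] by blast
  moreover have "commutator (d x) x \<in> P"
    using prime_ideal_commuting[OF P(1) assms(1) assms(6) _ x(1)] assms(7) P(2) by blast
  ultimately show False by simp
qed

end
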